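(* Let $d$ be an odd positive integer and let $\chi$ be a Dirichlet character with conductor $d$. Let $w_1,w_2\in\mathbb N$ with $w_1\equiv 1 \pmod 2$ and $w_2\equiv 1\pmod 2$. Then for every integer $n\ge 0$, every integer $m\ge 1$, and all $x,y$, $$\sum_{j=0}^n \binom{n}{j}w_2^{j}w_1^{n-j}E_{n-j,\chi}^{(m)}(w_2 x) \sum_{k=0}^j\binom{j}{k}T_{k,\chi}(w_1d-1)\,E_{j-k,\chi}^{(m-1)}(w_1y)$$ $$=\sum_{j=0}^n\binom{n}{j}w_1^{j}w_2^{n-j}E_{n-j,\chi}^{(m)}(w_1x)\sum_{k=0}^j\binom{j}{k}T_{k,\chi}(w_2d-1)\,E_{j-k,\chi}^{(m-1)}(w_2y).$$
   Context: $d$ is an odd positive integer and $\chi$ is a Dirichlet character with conductor $d$ (regarded as a complex-valued function on the integers, periodic mod $d$; for $d=1$, $\chi$ is identically $1$, including $\chi(0)=1$). For an integer $\alpha\ge 0$, the generalized higher-order Euler polynomials $E_{n,\chi}^{(\alpha)}(x)$ attached to $\chi$ are defined by $$\left(\frac{2\sum_{a=0}^{d-1}(-1)^a\chi(a)e^{at}}{e^{dt}+1}\right)^{\alpha}e^{xt}=\sum_{n=0}^{\infty}E_{n,\chi}^{(\alpha)}(x)\frac{t^n}{n!},\qquad |t|<\frac{\pi}{d}$$ (equivalently, as an identity of formal power series in $t$), where the $0$-th power is $1$, so that $E_{n,\chi}^{(0)}(x)=x^n$. The variables $x,y$ are indeterminates (or arbitrary complex numbers). For integers $k,N\ge 0$,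 $$T_{k,\chi}(N)=\sum_{l=0}^{N}(-1)^l\chi(l)\,l^k,$$ with the convention $0^0=1$. *)

theory Defs
  imports
    Complex_Main
    "HOL-Number_Theory.Cong"
    "HOL-Computational_Algebra.Formal_Power_Series"
begin

definition dirichlet_character :: "nat \<Rightarrow> (int \<Rightarrow> complex) \<Rightarrow> bool" where
  "dirichlet_character n \<chi> \<longleftrightarrow>
     n > 0 \<and>
     (\<forall>a. \<chi> (a + int n) = \<chi> a) \<and>
     (\<forall>a. \<chi> a \<noteq> 0 \<longleftrightarrow> coprime a (int n)) \<and>
     (\<forall>a b. \<chi> (a * b) = \<chi> a * \<chi> b)"

(* The conductor is the least induced modulus; chi is primitive iff conductor n chi = n. *)
definition induced_modulus :: "nat \<Rightarrow> (int \<Rightarrow> complex) \<Rightarrow> nat \<Rightarrow> bool" where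
  "induced_modulus n \<chi> k \<longleftrightarrow>
     k > 0 \<and> k dvd n \<and> (\<forall>a. coprime a (int n) \<longrightarrow> [a = 1] (mod int k) \<longrightarrow> \<chi> a = 1)"

definition conductor :: "nat \<Rightarrow> (int \<Rightarrow> complex) \<Rightarrow> nat" where
  "conductor n \<chi> = (LEAST k. induced_modulus n \<chi> k)"

definition euler_gf :: "nat \<Rightarrow> (int \<Rightarrow> complex) \<Rightarrow> complex fps" where
  "euler_gf d \<chi> =
     (2 * (\<Sum>a<d. fps_const ((-1) ^ a * \<chi> (int a)) * fps_exp (of_nat a)))
       / (fps_exp (of_nat d) + 1)"

(* E_{n,chi}^{(alpha)}(x), read off as the coefficient of t^n/n! in the generating series. *)
definition euler_poly :: "nat \<Rightarrow> (int \<Rightarrow> complex) \<Rightarrow> nat \<Rightarrow> nat \<Rightarrow> complex \<Rightarrow> complex" where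
  "euler_poly d \<chi> \<alpha> n x = fact n * fps_nth (euler_gf d \<chi> ^ \<alpha> * fps_exp x) n"

definition alt_power_sum :: "(int \<Rightarrow> complex) \<Rightarrow> nat \<Rightarrow> nat \<Rightarrow> complex" where
  "alt_power_sum \<chi> k N = (\<Sum>l=0..N. (-1) ^ l * \<chi> (int l) * of_nat l ^ k)"

lemma dirichlet_character_1_iff: "dirichlet_character 1 \<chi> \<longleftrightarrow> \<chi> = (\<lambda>_. 1)"
proof
  assume *: "dirichlet_character 1 \<chi>"
  have "\<chi> a = 1" for a
  proof -
    have "\<chi> a * \<chi> 0 = \<chi> 0" "\<chi> 0 \<noteq> 0"
      using * unfolding dirichlet_character_def
      by (metis mult_zero_right, simp)
    then show ?thesis by simp
  qed
  then show "\<chi> = (\<lambda>_. 1)" by blast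
qed (simp add: dirichlet_character_def)

(* The denominator has constant term 2, so the quotient in euler_gf is a true one. *)
lemma euler_gf_mult:
  "euler_gf d \<chi> * (fps_exp (of_nat d) + 1) =
     2 * (\<Sum>a<d. fps_const ((-1) ^ a * \<chi> (int a)) * fps_exp (of_nat a))"
proof -
  have nz: "fps_nth (fps_exp (of_nat d :: complex) + 1) 0 \<noteq> 0" by simp
  show ?thesis
    unfolding euler_gf_def fps_divide_unit[OF nz]
    by (simp only: mult.assoc inverse_mult_eq_1[OF nz] mult_1_right)
qed

lemma euler_poly_egf:
  "Abs_fps (\<lambda>n. euler_poly d \<chi> \<alpha> n x / fact n) = euler_gf d \<chi> ^ \<alpha> * fps_exp x"
  by (rule fps_ext) (simp add: euler_poly_def)

lemma euler_poly_0: "euler_poly d \<chi> 0 n x = x ^ n"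
  by (simp add: euler_poly_def)

end

theory Submission
  imports Defs
begin

text \<open>
  Let \<open>G(t)\<close> be the generating series of the Euler numbers attached to \<open>\<chi>\<close>. Since \<open>d\<close> and \<open>w\<close> are odd,
  periodicity of \<open>\<chi>\<close> and a geometric sum give
  \<open>2 \<Sum>\<^sub>l\<^sub><\<^sub>w\<^sub>d (-1)\<^sup>l \<chi>(l) e\<^sup>l\<^sup>t = G(t) (e\<^sup>w\<^sup>d\<^sup>t + 1)\<close>. Hence twice the left-hand side is \<open>n!\<close> times the
  coefficient of \<open>t\<^sup>n\<close> in \<open>G(w\<^sub>1t)\<^sup>m G(w\<^sub>2t)\<^sup>m exp(w\<^sub>1w\<^sub>2(x+y)t) (exp(w\<^sub>1w\<^sub>2dt) + 1)\<close>, which is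
  symmetric in \<open>w\<^sub>1\<close> and \<open>w\<^sub>2\<close>.
\<close>

text \<open>Product rule for exponential generating functions. It is applied twice, to the inner and
  to the outer binomial sum.\<close>

lemma fact_mult_fps_nth_mult:
  fixes f g :: "'a::field_char_0 fps"
  shows "fact n * fps_nth (f * g) n =
    (\<Sum>j=0..n. of_nat (n choose j) * (fact j * fps_nth f j) * (fact (n - j) * fps_nth g (n - j)))"
  by (auto simp: fps_mult_nth sum_distrib_left binomial_fact intro!: sum.cong)

text \<open>The exclusive bound makes \<open>N = d\<close> give half the numerator of
  \<open>euler_gf\<close>, and \<open>N = w * d\<close> split into \<open>w\<close> full periods of
  \<chi>.\<close>

definition alt_exp_sum :: "(int \<Rightarrow> complex) \<Rightarrow> nat \<Rightarrow> complex fps" where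
  "alt_exp_sum \<chi> N = (\<Sum>l<N. fps_const ((-1) ^ l * \<chi> (int l)) * fps_exp (of_nat l))"

lemma alt_power_sum_eq_fps_nth:
  assumes "N > 0"
  shows "alt_power_sum \<chi> k (N - 1) = fact k * fps_nth (alt_exp_sum \<chi> N) k"
proof -
  have "{0..N - 1} = {..<N}" using assms by auto
  then show ?thesis
    by (simp add: alt_power_sum_def alt_exp_sum_def fps_sum_nth sum_distrib_left)
qed

lemma sum_lessThan_add:
  fixes f :: "nat \<Rightarrow> 'a::comm_monoid_add"
  shows "sum f {..<m + n} = sum f {..<m} + (\<Sum>i<n. f (m + i))"
  by (induction n) (simp_all add: add.assoc)

text \<open>The last \<open>d\<close> terms repeat the first period: \<chi> is unchanged, the sign
  changes by \<open>(-1) ^ (w * d) = (-1) ^ w\<close> as \<open>d\<close> is odd, and the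
  exponentials gain a common factor.\<close>

lemma alt_exp_sum_add_period_multiple:
  assumes "odd d" and period: "\<forall>a. \<chi> (a + int d) = \<chi> a"
  shows "alt_exp_sum \<chi> (w * d + d) =
    alt_exp_sum \<chi> (w * d) + (- fps_exp (of_nat d)) ^ w * alt_exp_sum \<chi> d"
proof -
  have per: "\<chi> (int (w * d + a)) = \<chi> (int a)" for a
  proof (induction w)
    case (Suc w)
    then show ?case using period[rule_format, of "int (w * d + a)"] by (simp add: algebra_simps)
  qed simp
  have sign: "(-1 :: complex) ^ (w * d + a) = (-1) ^ w * (-1) ^ a" for a
    using \<open>odd d\<close> by (simp add: power_add minus_one_power_iff)
  have pow: "(- fps_exp (of_nat d :: complex)) ^ w = fps_const ((-1) ^ w) * fps_exp (of_nat (w * d))"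
    by (cases "even w") (simp_all add: fps_exp_power_mult fps_const_neg[symmetric])
  have "alt_exp_sum \<chi> (w * d + d) = alt_exp_sum \<chi> (w * d) +
      (\<Sum>a<d. fps_const ((-1) ^ (w * d + a) * \<chi> (int (w * d + a))) * fps_exp (of_nat (w * d + a)))"
    unfolding alt_exp_sum_def by (rule sum_lessThan_add)
  also have "(\<Sum>a<d. fps_const ((-1) ^ (w * d + a) * \<chi> (int (w * d + a))) * fps_exp (of_nat (w * d + a)))
      = (- fps_exp (of_nat d)) ^ w * alt_exp_sum \<chi> d"
    unfolding alt_exp_sum_def sum_distrib_left per sign pow
    unfolding of_nat_add fps_exp_add_mult
    by (intro sum.cong refl) (simp only: fps_const_mult[symmetric] mult_ac)
  finally show ?thesis .
qed

text \<open>The periods form a geometric progression with ratio \<open>- fps_exp (of_nat d)\<close>.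
  Multiplying out the denominator avoids division of power series.\<close>

lemma alt_exp_sum_geometric:
  assumes "odd d" and "\<forall>a. \<chi> (a + int d) = \<chi> a"
  shows "(fps_exp (of_nat d) + 1) * alt_exp_sum \<chi> (w * d) =
    alt_exp_sum \<chi> d * (1 - (- fps_exp (of_nat d)) ^ w)"
proof (induction w)
  case (Suc w)
  have "alt_exp_sum \<chi> (Suc w * d) =
      alt_exp_sum \<chi> (w * d) + (- fps_exp (of_nat d)) ^ w * alt_exp_sum \<chi> d"
    using alt_exp_sum_add_period_multiple[OF assms, of w] by (simp add: add.commute)
  then show ?case
    using Suc by (simp add: algebra_simps)
qed (simp add: alt_exp_sum_def)

lemma two_alt_exp_sum:
  assumes "odd d" and "\<forall>a. \<chi> (a + int d) = \<chi> a" and "odd w"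
  shows "2 * alt_exp_sum \<chi> (w * d) = euler_gf d \<chi> * (fps_exp (of_nat (w * d)) + 1)"
proof -
  let ?E = "fps_exp (of_nat d) :: complex fps"
  \<comment> \<open>The constant term is 2, so this factor can be cancelled at the end.\<close>
  have "fps_nth (?E + 1) 0 \<noteq> fps_nth 0 0" by simp
  then have nz: "?E + 1 \<noteq> 0" by metis
  have pow: "1 - (- ?E) ^ w = fps_exp (of_nat (w * d)) + 1"
    using \<open>odd w\<close> by (simp add: fps_exp_power_mult)
  have "(?E + 1) * (2 * alt_exp_sum \<chi> (w * d)) =
      2 * alt_exp_sum \<chi> d * (fps_exp (of_nat (w * d)) + 1)"
    using alt_exp_sum_geometric[OF assms(1,2), of w] unfolding pow by (simp only: mult_ac)
  also have "2 * alt_exp_sum \<chi> d = euler_gf d \<chi> * (?E + 1)"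
    unfolding alt_exp_sum_def by (rule euler_gf_mult[symmetric])
  finally have "(?E + 1) * (2 * alt_exp_sum \<chi> (w * d)) =
      (?E + 1) * (euler_gf d \<chi> * (fps_exp (of_nat (w * d)) + 1))"
    by (simp only: mult_ac)
  then show ?thesis using nz by simp
qed

text \<open>Stated for generic \<open>v\<close> and \<open>w\<close>, so that both sides of the
  theorem are instances with the two roles exchanged.\<close>

lemma euler_convolution_symmetric_form:
  fixes d v w :: nat and x y :: complex
  assumes "odd d" and "\<forall>a. \<chi> (a + int d) = \<chi> a" and "odd v" and "m \<ge> 1"
  defines "G \<equiv> \<lambda>w. fps_compose (euler_gf d \<chi>) (fps_const (of_nat w) * fps_X)"
  shows "2 * (\<Sum>j=0..n. of_nat (n choose j) * of_nat w ^ j * of_nat v ^ (n - j)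
        * euler_poly d \<chi> m (n - j) (of_nat w * x)
        * (\<Sum>k=0..j. of_nat (j choose k) * alt_power_sum \<chi> k (v * d - 1)
             * euler_poly d \<chi> (m - 1) (j - k) (of_nat v * y)))
    = fact n * fps_nth (G v ^ m * G w ^ m * fps_exp (of_nat (v * w) * (x + y))
        * (fps_exp (of_nat (v * w * d)) + 1)) n"
    (is "2 * ?L = fact n * fps_nth ?R n")
proof -
  \<comment> \<open>The substitution of \<open>c * t\<close> for \<open>t\<close> is a ring
    homomorphism; its coefficient scaling absorbs the powers of \<open>w\<close> and
    \<open>v\<close> in the outer sum.\<close>
  define D where "D c f = fps_compose f (fps_const (of_nat c) * fps_X)" for c and f :: "complex fps"
  have D_nth: "fps_nth (D c f) k = of_nat c ^ k * fps_nth f k" for c f k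
    by (simp add: D_def fps_compose_linear)
  have D_mult: "D c (f * g) = D c f * D c g" for c f g
    by (simp add: D_def fps_compose_mult_distrib)
  have D_add: "D c (f + g) = D c f + D c g" for c f g
    by (simp add: D_def fps_compose_add_distrib)
  have D_power: "D c (f ^ k) = D c f ^ k" for c f k
    by (simp add: D_def fps_compose_power)
  have D_exp: "D c (fps_exp a) = fps_exp (of_nat c * a)" for c a
    by (simp add: D_def)
  have D_1: "D c 1 = 1" and D_2: "D c 2 = 2" for c
    by (simp_all add: D_def)
  \<comment> \<open>Positivity keeps the truncated subtraction in \<open>v * d - 1\<close> from
    changing the range of summation.\<close>
  have "v * d > 0" using assms(1,3) by (auto intro: odd_pos)
  define A where "A = euler_gf d \<chi> ^ m * fps_exp (of_nat w * x)"
  define B where "B = alt_exp_sum \<chi> (v * d) * (euler_gf d \<chi> ^ (m - 1) * fps_exp (of_nat v * y))"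
  have inner: "(\<Sum>k=0..j. of_nat (j choose k) * alt_power_sum \<chi> k (v * d - 1)
      * euler_poly d \<chi> (m - 1) (j - k) (of_nat v * y)) = fact j * fps_nth B j" for j
    unfolding B_def fact_mult_fps_nth_mult alt_power_sum_eq_fps_nth[OF \<open>v * d > 0\<close>] euler_poly_def ..
  have "?L = fact n * fps_nth (D w B * D v A) n"
    unfolding fact_mult_fps_nth_mult inner D_nth
    by (intro sum.cong refl) (simp only: euler_poly_def A_def mult_ac)
  then have "2 * ?L = fact n * fps_nth (2 * (D w B * D v A)) n"
    by (simp only: mult_2 fps_add_nth distrib_left)
  also have "2 * (D w B * D v A) = D w (2 * B) * D v A"
    by (simp only: D_mult D_2 mult.assoc)
  also have "2 * B = 2 * alt_exp_sum \<chi> (v * d) * euler_gf d \<chi> ^ (m - 1) * fps_exp (of_nat v * y)"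
    by (simp only: B_def mult.assoc)
  \<comment> \<open>The alternating sum supplies the factor \<open>euler_gf d \<chi>\<close> that
    raises the exponent from \<open>m - 1\<close> to \<open>m\<close>, as in
    \<open>A\<close>.\<close>
  also have "\<dots> = euler_gf d \<chi> ^ m * (fps_exp (of_nat (v * d)) + 1) * fps_exp (of_nat v * y)"
    unfolding two_alt_exp_sum[OF assms(1-3)] using \<open>m \<ge> 1\<close> by (cases m) (simp_all add: mult_ac)
  also have "D w \<dots> * D v A = G w ^ m * (fps_exp (of_nat w * of_nat (v * d)) + 1)
      * fps_exp (of_nat w * (of_nat v * y)) * (G v ^ m * fps_exp (of_nat v * (of_nat w * x)))"
    unfolding A_def D_mult D_add D_power D_exp D_1 by (simp only: D_def G_def)
  also have "\<dots> = ?R"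
    unfolding distrib_left[of _ x y] fps_exp_add_mult by (simp add: mult_ac)
  finally show ?thesis .
qed

theorem theorem1:
  fixes d w\<^sub>1 w\<^sub>2 n m :: nat and \<chi> :: "int \<Rightarrow> complex" and x y :: complex
  assumes "odd d"
    and "dirichlet_character d \<chi>" and "conductor d \<chi> = d"
    and "odd w\<^sub>1" and "odd w\<^sub>2"
    and "m \<ge> 1"
  shows
    "(\<Sum>j=0..n. of_nat (n choose j) * of_nat w\<^sub>2 ^ j * of_nat w\<^sub>1 ^ (n - j)
        * euler_poly d \<chi> m (n - j) (of_nat w\<^sub>2 * x)
        * (\<Sum>k=0..j. of_nat (j choose k) * alt_power_sum \<chi> k (w\<^sub>1 * d - 1)
             * euler_poly d \<chi> (m - 1) (j - k) (of_nat w\<^sub>1 * y)))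
   = (\<Sum>j=0..n. of_nat (n choose j) * of_nat w\<^sub>1 ^ j * of_nat w\<^sub>2 ^ (n - j)
        * euler_poly d \<chi> m (n - j) (of_nat w\<^sub>1 * x)
        * (\<Sum>k=0..j. of_nat (j choose k) * alt_power_sum \<chi> k (w\<^sub>2 * d - 1)
             * euler_poly d \<chi> (m - 1) (j - k) (of_nat w\<^sub>2 * y)))" (is "?L = ?R")
proof -
  have "\<forall>a. \<chi> (a + int d) = \<chi> a"
    using assms(2) by (simp add: dirichlet_character_def)
  note form = euler_convolution_symmetric_form[OF \<open>odd d\<close> this _ \<open>m \<ge> 1\<close>]
  \<comment> \<open>Both closed forms agree up to commutativity of multiplication.\<close>
  have "2 * ?L = 2 * ?R"
    unfolding form[OF \<open>odd w\<^sub>1\<close>] form[OF \<open>odd w\<^sub>2\<close>] by (simp only: mult_ac)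
  then show "?L = ?R" by (simp only: mult_cancel_left) simp
qed

end
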